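(* Let $(G,\cdot,\star)$ be a multiplicative Lie algebra whose underlying group $G$ is nilpotent of class $2$. If $G$ is a nilpotent multiplicative Lie algebra, then $G$ is Lie nilpotent. Likewise, if $G$ is a solvable multiplicative Lie algebra, then $G$ is Lie solvable.
   Context: Notation: ${}^xy=xyx^{-1}$ and $[x,y]=xyx^{-1}y^{-1}$. A multiplicative Lie algebra is a triple $(G,\cdot,\star)$ where $(G,\cdot)$ is a group and $\star$ is a binary operation on $G$ such that for all $x,y,z\in G$: (i) $x\star x=1$; (ii) $x\star(yz)=(x\star y)\,{}^y(x\star z)$; (iii) $(xy)\star z={}^x(y\star z)\,(x\star z)$; (iv) $((x\star y)\star{}^yz)((y\star z)\star{}^zx)((z\star x)\star{}^xy)=1$; (v) ${}^z(x\star y)=({}^zx)\star({}^zy)$. An ideal of $G$ is a normal subgroup $I$ with $g\star i\in I$ for all $g\in G$, $i\in I$. A group $G$ is nilpotent of class $2$ if $[G,G]\subseteq Z(G)$. For subgroups $A,B$ of $G$, $A\star B$ denotes the subgroup generated by $\{a\star b\mid a\in A,b\in B\}$. Put ${}^L[a,b]=(a\star b)^{-1}[a,b]$. $G$ is a nilpotent multiplicative Lie algebra if $\Gamma_{(n)}(G)=1$ for some $n$, where $\Gamma_{(1)}(G)=G$ and $\Gamma_{(k+1)}(G)=G\star\Gamma_{(k)}(G)$ for $k\ge1$. $G$ is a solvable multiplicative Lie algebra if $\Gamma^{(n)}(G)=1$ for some $n$, where $\Gamma^{(0)}(G)=G$ and $\Gamma^{(k+1)}(G)=\Gamma^{(k)}(G)\star\Gamma^{(k)}(G)$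 for $k\ge0$. $G$ is Lie nilpotent if $L_n(G)=1$ for some $n$, where $L_0(G)=G$ and $L_{k+1}(G)={}^L[G,L_k(G)]$ is the ideal of $G$ generated by $\{{}^L[g,h]\mid g\in G,h\in L_k(G)\}$ for $k\ge0$. $G$ is Lie solvable if $G^{(n)}=1$ for some $n$, where $G^{(0)}=G$ and $G^{(k+1)}={}^L[G^{(k)},G^{(k)}]$ is the ideal of the multiplicative Lie algebra $G^{(k)}$ generated by $\{{}^L[g,h]\mid g,h\in G^{(k)}\}$ for $k\ge0$. *)

theory Defs
  imports "HOL-Algebra.Algebra"
begin

record 'a mult_lie = "'a monoid" +
  star :: "['a, 'a] \<Rightarrow> 'a" (infixl \<open>\<star>\<index>\<close> 70)

definition conjugate :: "('a, 'b) monoid_scheme \<Rightarrow> 'a \<Rightarrow> 'a \<Rightarrow> 'a" where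
  "conjugate G x y = x \<otimes>\<^bsub>G\<^esub> y \<otimes>\<^bsub>G\<^esub> inv\<^bsub>G\<^esub> x"

definition commutator :: "('a, 'b) monoid_scheme \<Rightarrow> 'a \<Rightarrow> 'a \<Rightarrow> 'a" where
  "commutator G x y = x \<otimes>\<^bsub>G\<^esub> y \<otimes>\<^bsub>G\<^esub> inv\<^bsub>G\<^esub> x \<otimes>\<^bsub>G\<^esub> inv\<^bsub>G\<^esub> y"

locale mult_lie_algebra = group G for G :: "('a, 'b) mult_lie_scheme" (structure) +
  assumes star_closed:
      "\<lbrakk>x \<in> carrier G; y \<in> carrier G\<rbrakk> \<Longrightarrow> x \<star> y \<in> carrier G"
    and star_self:
      "x \<in> carrier G \<Longrightarrow> x \<star> x = \<one>"
    and star_mult_right: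
      "\<lbrakk>x \<in> carrier G; y \<in> carrier G; z \<in> carrier G\<rbrakk> \<Longrightarrow>
         x \<star> (y \<otimes> z) = (x \<star> y) \<otimes> conjugate G y (x \<star> z)"
    and star_mult_left:
      "\<lbrakk>x \<in> carrier G; y \<in> carrier G; z \<in> carrier G\<rbrakk> \<Longrightarrow>
         (x \<otimes> y) \<star> z = conjugate G x (y \<star> z) \<otimes> (x \<star> z)"
    and star_jacobi:
      "\<lbrakk>x \<in> carrier G; y \<in> carrier G; z \<in> carrier G\<rbrakk> \<Longrightarrow>
         ((x \<star> y) \<star> conjugate G y z) \<otimes> ((y \<star> z) \<star> conjugate G z x)
           \<otimes> ((z \<star> x) \<star> conjugate G x y) = \<one>"
    and star_conjugate:
      "\<lbrakk>x \<in> carrier G; y \<in> carrier G; z \<in> carrier G\<rbrakk> \<Longrightarrow>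
         conjugate G z (x \<star> y) = conjugate G z x \<star> conjugate G z y"

definition mult_lie_ideal :: "'a set \<Rightarrow> ('a, 'b) mult_lie_scheme \<Rightarrow> bool" where
  "mult_lie_ideal I G \<longleftrightarrow> I \<lhd> G \<and> (\<forall>g\<in>carrier G. \<forall>i\<in>I. g \<star>\<^bsub>G\<^esub> i \<in> I)"

definition ideal_generated :: "('a, 'b) mult_lie_scheme \<Rightarrow> 'a set \<Rightarrow> 'a set" where
  "ideal_generated G S = \<Inter>{I. mult_lie_ideal I G \<and> S \<subseteq> I}"

definition group_center :: "('a, 'b) monoid_scheme \<Rightarrow> 'a set" where
  "group_center G = {z \<in> carrier G. \<forall>g\<in>carrier G. z \<otimes>\<^bsub>G\<^esub> g = g \<otimes>\<^bsub>G\<^esub> z}"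

(* The class is at most 2: abelian groups are included. *)
definition nilpotent_class_2 :: "('a, 'b) monoid_scheme \<Rightarrow> bool" where
  "nilpotent_class_2 G \<longleftrightarrow> derived G (carrier G) \<subseteq> group_center G"

definition star_subgroup :: "('a, 'b) mult_lie_scheme \<Rightarrow> 'a set \<Rightarrow> 'a set \<Rightarrow> 'a set" where
  "star_subgroup G A B = generate G {a \<star>\<^bsub>G\<^esub> b | a b. a \<in> A \<and> b \<in> B}"

(* The bracket \<^sup>L[a,b]. *)
definition lie_commutator :: "('a, 'b) mult_lie_scheme \<Rightarrow> 'a \<Rightarrow> 'a \<Rightarrow> 'a" where
  "lie_commutator G a b = inv\<^bsub>G\<^esub> (a \<star>\<^bsub>G\<^esub> b) \<otimes>\<^bsub>G\<^esub> commutator G a b"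

(* star_lower_series G n is \<Gamma>\<^sub>(\<^sub>n\<^sub>)(G), which is indexed from 1; the value at 0 is a dummy. *)
fun star_lower_series :: "('a, 'b) mult_lie_scheme \<Rightarrow> nat \<Rightarrow> 'a set" where
  "star_lower_series G 0 = carrier G"
| "star_lower_series G (Suc 0) = carrier G"
| "star_lower_series G (Suc (Suc k)) =
     star_subgroup G (carrier G) (star_lower_series G (Suc k))"

definition nilpotent_mult_lie :: "('a, 'b) mult_lie_scheme \<Rightarrow> bool" where
  "nilpotent_mult_lie G \<longleftrightarrow> (\<exists>n\<ge>1. star_lower_series G n = {\<one>\<^bsub>G\<^esub>})"

primrec star_derived_series :: "('a, 'b) mult_lie_scheme \<Rightarrow> nat \<Rightarrow> 'a set" where
  "star_derived_series G 0 = carrier G"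
| "star_derived_series G (Suc k) =
     star_subgroup G (star_derived_series G k) (star_derived_series G k)"

definition solvable_mult_lie :: "('a, 'b) mult_lie_scheme \<Rightarrow> bool" where
  "solvable_mult_lie G \<longleftrightarrow> (\<exists>n. star_derived_series G n = {\<one>\<^bsub>G\<^esub>})"

primrec lie_lower_series :: "('a, 'b) mult_lie_scheme \<Rightarrow> nat \<Rightarrow> 'a set" where
  "lie_lower_series G 0 = carrier G"
| "lie_lower_series G (Suc k) =
     ideal_generated G
       {lie_commutator G g h | g h. g \<in> carrier G \<and> h \<in> lie_lower_series G k}"

definition lie_nilpotent :: "('a, 'b) mult_lie_scheme \<Rightarrow> bool" where
  "lie_nilpotent G \<longleftrightarrow> (\<exists>n. lie_lower_series G n = {\<one>\<^bsub>G\<^esub>})"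

(* Each term is an ideal generated in the preceding term, not in G. *)
primrec lie_derived_series :: "('a, 'b) mult_lie_scheme \<Rightarrow> nat \<Rightarrow> 'a set" where
  "lie_derived_series G 0 = carrier G"
| "lie_derived_series G (Suc k) =
     ideal_generated (G\<lparr>carrier := lie_derived_series G k\<rparr>)
       {lie_commutator G g h | g h.
          g \<in> lie_derived_series G k \<and> h \<in> lie_derived_series G k}"

definition lie_solvable :: "('a, 'b) mult_lie_scheme \<Rightarrow> bool" where
  "lie_solvable G \<longleftrightarrow> (\<exists>n. lie_derived_series G n = {\<one>\<^bsub>G\<^esub>})"

end

theory Submission
  imports Defs
begin

text \<open>
The Lie bracket is the inverse of a star product times a group commutator. The star series
control the first factor; the point is to control the second one, and above all what happens when
commutators are fed back into the star.

The tool for this is the identity \<open>star_commutator\<close>, valid in every multiplicative Lie algebra: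
the star of \<open>z\<close> with the commutator of \<open>x\<close> and \<open>y\<close> is the commutator of \<open>z\<close> with the star of
\<open>x\<close> and \<open>y\<close>. As \<open>z \<star> _\<close> is a homomorphism up to conjugation, it determines the star
product with every element of a commutator subgroup. In a group of class two commutators are
central, so that products with them can be taken apart freely.

For nilpotency, let \<open>C n\<close> be the subgroup generated by the commutators of arbitrary elements with elements
of the \<open>n\<close>-th term of the lower star series. By \<open>lie_commutator_step\<close>, bracketing with
an arbitrary element sends the \<open>(n + 1)\<close>-th term of that series times \<open>C n\<close> into the
\<open>(n + 2)\<close>-th term times \<open>C (n + 1)\<close>: the identity above converts a star with a commutator
into a commutator with a star. Hence the \<open>n\<close>-th term of the Lie lower series lies
in the \<open>(n + 1)\<close>-th term of the star series times \<open>C n\<close> (\<open>lie_lower_series_subset\<close>), and the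
latter product is trivial as soon as the \<open>n\<close>-th term of the star series is.

For solvability it suffices to work modulo the derived subgroup \<open>K\<close>, a central ideal. The
Lie derived series lies in the star derived series times \<open>K\<close>
(\<open>lie_derived_series_invariant\<close>), so it eventually lies in \<open>K\<close>. Now \<open>K \<star> K\<close> is trivial, because by
the identity its generators are products of commutators with central elements (\<open>K_star_K\<close>), and commutators of
elements of \<open>K\<close> are trivial too; one further step therefore reaches the trivial group.
\<close>

section \<open>Conjugates and commutators in a group\<close>

context group
begin

lemma inv_mult_cancel:
  assumes "x \<in> carrier G" "y \<in> carrier G"
  shows "inv x \<otimes> (x \<otimes> y) = y" and "x \<otimes> (inv x \<otimes> y) = y"
  using assms by (simp_all flip: m_assoc)

lemma conjugate_closed:
  "\<lbrakk>x \<in> carrier G; y \<in> carrier G\<rbrakk> \<Longrightarrow> conjugate G x y \<in> carrier G"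
  by (simp add: conjugate_def)

lemma commutator_closed:
  "\<lbrakk>x \<in> carrier G; y \<in> carrier G\<rbrakk> \<Longrightarrow> commutator G x y \<in> carrier G"
  by (simp add: commutator_def)

lemma conjugate_mult_right:
  "\<lbrakk>x \<in> carrier G; y \<in> carrier G; z \<in> carrier G\<rbrakk> \<Longrightarrow>
     conjugate G x (y \<otimes> z) = conjugate G x y \<otimes> conjugate G x z"
  by (simp add: conjugate_def m_assoc inv_mult_cancel)

lemma conjugate_mult_left:
  "\<lbrakk>x \<in> carrier G; y \<in> carrier G; z \<in> carrier G\<rbrakk> \<Longrightarrow>
     conjugate G (x \<otimes> y) z = conjugate G x (conjugate G y z)"
  by (simp add: conjugate_def m_assoc inv_mult_group)

lemma conjugate_cancel:
  "\<lbrakk>x \<in> carrier G; y \<in> carrier G\<rbrakk> \<Longrightarrow> conjugate G (inv x) (conjugate G x y) = y"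
  by (simp add: conjugate_def m_assoc inv_mult_cancel)

lemma normal_conjugate_closed:
  "\<lbrakk>N \<lhd> G; x \<in> carrier G; y \<in> N\<rbrakk> \<Longrightarrow> conjugate G x y \<in> N"
  by (simp add: conjugate_def normal.inv_op_closed2)

lemma commutator_conjugate:
  assumes "x \<in> carrier G" "a \<in> carrier G" "b \<in> carrier G"
  shows "conjugate G x (commutator G a b) =
         commutator G (conjugate G x a) (conjugate G x b)"
  using assms
  by (simp add: conjugate_def commutator_def m_assoc inv_mult_group inv_mult_cancel)

lemma inv_commutator:
  "\<lbrakk>x \<in> carrier G; y \<in> carrier G\<rbrakk> \<Longrightarrow> inv (commutator G x y) = commutator G y x"
  by (simp add: commutator_def m_assoc inv_mult_group)

end

lemma normal_mem_carrier: "\<lbrakk>N \<lhd> G; x \<in> N\<rbrakk> \<Longrightarrow> x \<in> carrier G"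
  by (rule subgroup.mem_carrier[OF normal_imp_subgroup])

lemma (in group) normal_generate_conjugate:
  assumes "S \<subseteq> carrier G"
    and "\<And>x s. \<lbrakk>x \<in> carrier G; s \<in> S\<rbrakk> \<Longrightarrow> conjugate G x s \<in> S"
  shows "generate G S \<lhd> G"
  using assms by (intro normal_generateI) (auto simp: conjugate_def)

definition commutator_subgroup :: "('a, 'b) monoid_scheme \<Rightarrow> 'a set \<Rightarrow> 'a set \<Rightarrow> 'a set" where
  "commutator_subgroup G A B = generate G {commutator G a b | a b. a \<in> A \<and> b \<in> B}"

context group
begin

lemma mem_commutator_subgroup:
  "\<lbrakk>a \<in> A; b \<in> B\<rbrakk> \<Longrightarrow> commutator G a b \<in> commutator_subgroup G A B"
  unfolding commutator_subgroup_def by (rule generate.incl) blast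

lemma commutator_subgroup_subset:
  assumes "subgroup N G"
    and "\<And>a b. \<lbrakk>a \<in> A; b \<in> B\<rbrakk> \<Longrightarrow> commutator G a b \<in> N"
  shows "commutator_subgroup G A B \<subseteq> N"
  unfolding commutator_subgroup_def using assms by (intro generate_subgroup_incl) auto

lemma commutator_subgroup_mono:
  assumes "A \<subseteq> A'" and "B \<subseteq> B'"
  shows "commutator_subgroup G A B \<subseteq> commutator_subgroup G A' B'"
  unfolding commutator_subgroup_def using assms by (intro mono_generate) blast

lemma commutator_subgroup_normal:
  assumes "A \<lhd> G" and "B \<lhd> G"
  shows "commutator_subgroup G A B \<lhd> G"
proof -
  have sub: "a \<in> carrier G" "b \<in> carrier G" if "a \<in> A" "b \<in> B" for a b
    using that assms by (auto intro: normal_mem_carrier)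
  show ?thesis
    unfolding commutator_subgroup_def
  proof (rule normal_generate_conjugate)
    show "{commutator G a b | a b. a \<in> A \<and> b \<in> B} \<subseteq> carrier G"
      using sub commutator_closed by blast
    fix x s assume x: "x \<in> carrier G"
      and "s \<in> {commutator G a b | a b. a \<in> A \<and> b \<in> B}"
    then obtain a b where s: "s = commutator G a b" and ab: "a \<in> A" "b \<in> B" by blast
    have "conjugate G x a \<in> A" "conjugate G x b \<in> B"
      using x ab assms by (simp_all add: normal_conjugate_closed)
    then show "conjugate G x s \<in> {commutator G a b | a b. a \<in> A \<and> b \<in> B}"
      using s commutator_conjugate[OF x sub[OF ab]] by blast
  qed
qed

lemma commutator_eq_one:
  "\<lbrakk>x \<in> carrier G; y \<in> carrier G; x \<otimes> y = y \<otimes> x\<rbrakk> \<Longrightarrow> commutator G x y = \<one>"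
  by (simp add: commutator_def m_assoc)

end

section \<open>Identities for the star operation\<close>

context mult_lie_algebra
begin

lemmas closed = star_closed conjugate_closed commutator_closed

lemma star_one_right:
  assumes "x \<in> carrier G"
  shows "x \<star> \<one> = \<one>"
  using star_mult_right[of x \<one> \<one>] assms
  by (simp add: conjugate_def closed)

text \<open>
Bilinearity up to conjugation turns \<^term>\<open>(y \<otimes> x) \<star> (y \<otimes> x) = \<one>\<close> into a conjugate
of the required relation, since the two diagonal terms vanish.
\<close>
lemma star_antisym:
  assumes [simp]: "x \<in> carrier G" "y \<in> carrier G"
  shows "(x \<star> y) \<otimes> (y \<star> x) = \<one>"
proof -
  have "\<one> = (y \<otimes> x) \<star> (y \<otimes> x)" by (simp add: star_self)
  also have "\<dots> = conjugate G y (x \<star> y) \<otimes> conjugate G y (y \<star> x)"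
    by (simp add: star_mult_left star_mult_right star_self[of x] star_self[of y] closed)
       (simp add: conjugate_def closed)
  also have "\<dots> = conjugate G y ((x \<star> y) \<otimes> (y \<star> x))"
    by (simp add: conjugate_mult_right closed)
  finally have "conjugate G y ((x \<star> y) \<otimes> (y \<star> x)) = \<one>" by simp
  then show ?thesis
    using conjugate_cancel[of y "(x \<star> y) \<otimes> (y \<star> x)"]
    by (simp add: closed conjugate_def[of G _ \<one>])
qed

lemma inv_star:
  "\<lbrakk>x \<in> carrier G; y \<in> carrier G\<rbrakk> \<Longrightarrow> inv (x \<star> y) = y \<star> x"
  using star_antisym[of y x] by (simp add: inv_equality closed)

text \<open>
The product \<^term>\<open>(x \<otimes> y) \<star> (u \<otimes> v)\<close> can be expanded first on the right or first on the
left. The two results have the same outer factors; cancelling them leaves this relation between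
the inner ones.
\<close>
lemma star_conjugates_star:
  assumes [simp]: "x \<in> carrier G" "y \<in> carrier G" "u \<in> carrier G" "v \<in> carrier G"
  shows "(x \<star> u) \<otimes> conjugate G (u \<otimes> x) (y \<star> v) = conjugate G (x \<otimes> u) (y \<star> v) \<otimes> (x \<star> u)"
proof -
  let ?p = "conjugate G x (y \<star> u)" and ?q = "conjugate G u (x \<star> v)"
  have "?p \<otimes> ((x \<star> u) \<otimes> conjugate G (u \<otimes> x) (y \<star> v)) \<otimes> ?q = (x \<otimes> y) \<star> (u \<otimes> v)"
    by (subst star_mult_right)
       (simp_all add: star_mult_left conjugate_mult_right conjugate_mult_left closed m_assoc)
  also have "\<dots> = ?p \<otimes> (conjugate G (x \<otimes> u) (y \<star> v) \<otimes> (x \<star> u)) \<otimes> ?q"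
    by (subst star_mult_left)
       (simp_all add: star_mult_right conjugate_mult_right conjugate_mult_left closed m_assoc)
  finally show ?thesis by (simp add: closed)
qed

text \<open>
A star product acts on star products as the corresponding commutator does. In the preceding
lemma, the factors \<^term>\<open>x \<otimes> u\<close> and \<^term>\<open>u \<otimes> x\<close> differ by this commutator; to isolate it,
the lemma is applied to \<^term>\<open>y\<close> and \<^term>\<open>v\<close> conjugated by \<^term>\<open>inv (u \<otimes> x)\<close>, which is
harmless because conjugation distributes over the star.
\<close>
lemma conjugate_star_eq_conjugate_commutator:
  assumes [simp]: "x \<in> carrier G" "u \<in> carrier G" "y \<in> carrier G" "v \<in> carrier G"
  shows "conjugate G (x \<star> u) (y \<star> v) = conjugate G (commutator G x u) (y \<star> v)"
proof -
  let ?r = "inv (u \<otimes> x)"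
  have *: "conjugate G g (conjugate G ?r z) = conjugate G (g \<otimes> ?r) z"
    if "g \<in> carrier G" "z \<in> carrier G" for g z
    using that by (simp add: conjugate_mult_left)
  have "(x \<star> u) \<otimes> (y \<star> v) = conjugate G (commutator G x u) (y \<star> v) \<otimes> (x \<star> u)"
    using star_conjugates_star[of x "conjugate G ?r y" u "conjugate G ?r v"]
    by (simp add: star_conjugate[symmetric] * closed)
       (simp add: inv_mult_group commutator_def conjugate_def closed m_assoc inv_mult_cancel)
  then show ?thesis
    by (subst (1) conjugate_def) (simp add: closed inv_solve_right')
qed

text \<open>
This identity is what allows commutators to be moved through the star. Let \<^term>\<open>w\<close> be
the conjugate of \<^term>\<open>z\<close> with \<^term>\<open>x \<otimes> w = z \<otimes> x\<close>, and expand \<^term>\<open>y \<star> (x \<otimes> w)\<close> and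
\<^term>\<open>y \<star> (z \<otimes> x)\<close>. One expansion contains the conjugate by \<^term>\<open>x\<close> of \<^term>\<open>y \<star> w\<close>,
that is, \<^term>\<open>(commutator G x y \<otimes> y) \<star> z\<close>; splitting that off produces the left-hand side, and the
action of commutators on star products removes the remaining conjugation.
\<close>
lemma commutator_star:
  assumes [simp]: "x \<in> carrier G" "y \<in> carrier G" "z \<in> carrier G"
  shows "commutator G x y \<star> z = commutator G (x \<star> y) z"
proof -
  define w where "w = conjugate G (inv x) z"
  have w [simp]: "w \<in> carrier G" by (simp add: w_def closed)
  have xw: "conjugate G x w = z"
    by (simp add: w_def conjugate_def m_assoc inv_mult_cancel)
  have xw_zx: "x \<otimes> w = z \<otimes> x"
    using xw by (metis assms(1) assms(3) conjugate_def inv_solve_right' m_closed w)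
  have comm_x: "commutator G x y \<otimes> y = conjugate G x y"
    by (simp add: commutator_def conjugate_def m_assoc)
  have "(y \<star> x) \<otimes> conjugate G x (y \<star> w) = y \<star> (x \<otimes> w)"
    by (simp add: star_mult_right)
  also have "\<dots> = (y \<star> z) \<otimes> conjugate G z (y \<star> x)"
    by (simp add: xw_zx star_mult_right)
  finally have 1: "(y \<star> x) \<otimes> conjugate G x (y \<star> w) = (y \<star> z) \<otimes> conjugate G z (y \<star> x)" .
  have "conjugate G x (y \<star> w) = (commutator G x y \<otimes> y) \<star> z"
    by (simp add: star_conjugate xw comm_x)
  also have "\<dots> = conjugate G (x \<star> y) (y \<star> z) \<otimes> (commutator G x y \<star> z)"
    by (simp add: star_mult_left closed conjugate_star_eq_conjugate_commutator)
  finally have "(y \<star> x) \<otimes> conjugate G x (y \<star> w)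
      = (y \<star> z) \<otimes> (y \<star> x) \<otimes> (commutator G x y \<star> z)"
    by (simp add: conjugate_def inv_star[symmetric, of x y] m_assoc closed inv_mult_cancel)
  with 1 have "(y \<star> x) \<otimes> (commutator G x y \<star> z) = conjugate G z (y \<star> x)"
    by (simp add: closed m_assoc)
  then have "commutator G x y \<star> z = inv (y \<star> x) \<otimes> conjugate G z (y \<star> x)"
    by (simp add: closed inv_solve_left)
  then show ?thesis
    by (simp add: inv_star conjugate_def commutator_def closed m_assoc)
qed

lemma star_commutator:
  assumes "x \<in> carrier G" "y \<in> carrier G" "z \<in> carrier G"
  shows "z \<star> commutator G x y = commutator G z (x \<star> y)"
  using assms commutator_star[of x y z]
  by (metis closed(1,3) inv_commutator inv_star)

end

section \<open>Ideals of a multiplicative Lie algebra\<close>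

lemma mult_lie_ideal_normal: "mult_lie_ideal I G \<Longrightarrow> I \<lhd> G"
  by (simp add: mult_lie_ideal_def)

lemma mult_lie_ideal_subgroup: "mult_lie_ideal I G \<Longrightarrow> subgroup I G"
  by (simp add: mult_lie_ideal_def normal_imp_subgroup)

lemma mult_lie_ideal_star:
  "\<lbrakk>mult_lie_ideal I G; g \<in> carrier G; i \<in> I\<rbrakk> \<Longrightarrow> g \<star>\<^bsub>G\<^esub> i \<in> I"
  by (simp add: mult_lie_ideal_def)

lemma ideal_generated_minimal:
  "\<lbrakk>mult_lie_ideal I G; S \<subseteq> I\<rbrakk> \<Longrightarrow> ideal_generated G S \<subseteq> I"
  unfolding ideal_generated_def by blast

lemma one_in_ideal_generated: "\<one>\<^bsub>G\<^esub> \<in> ideal_generated G S"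
  unfolding ideal_generated_def by (auto dest: mult_lie_ideal_subgroup subgroup.one_closed)

text \<open>
The ideal \<^term>\<open>I\<close> guarantees that the intersection is not over the empty family, in which case it
would be the whole type.
\<close>
lemma ideal_generated_ideal:
  fixes H :: "('a, 'b) mult_lie_scheme"
  assumes "group H" and "mult_lie_ideal I H" and "S \<subseteq> I"
  shows "mult_lie_ideal (ideal_generated H S) H"
proof -
  let ?A = "{I. mult_lie_ideal I H \<and> S \<subseteq> I}"
  have "subgroup (\<Inter>?A) H"
    using assms by (intro group.subgroups_Inter) (auto dest: mult_lie_ideal_subgroup)
  moreover have "x \<otimes>\<^bsub>H\<^esub> h \<otimes>\<^bsub>H\<^esub> inv\<^bsub>H\<^esub> x \<in> \<Inter>?A" if "x \<in> carrier H" "h \<in> \<Inter>?A" for x h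
    using that mult_lie_ideal_normal normal.inv_op_closed2 by fastforce
  ultimately have "\<Inter>?A \<lhd> H"
    using assms(1) by (simp add: group.normal_inv_iff)
  then show ?thesis
    unfolding mult_lie_ideal_def[of "ideal_generated H S"] unfolding ideal_generated_def
    by (auto intro: mult_lie_ideal_star)
qed

context mult_lie_algebra
begin

lemma carrier_ideal: "mult_lie_ideal (carrier G) G"
  by (simp add: mult_lie_ideal_def normal_self closed)

lemma trivial_ideal: "mult_lie_ideal {\<one>} G"
  by (simp add: mult_lie_ideal_def one_is_normal star_one_right)

lemma set_mult_ideal:
  assumes "mult_lie_ideal I G" and "mult_lie_ideal J G"
  shows "mult_lie_ideal (I <#> J) G"
proof -
  have carr: "i \<in> carrier G" "j \<in> carrier G" if "i \<in> I" "j \<in> J" for i j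
    using that assms by (auto intro: normal_mem_carrier mult_lie_ideal_normal)
  have "g \<star> (i \<otimes> j) \<in> I <#> J" if "g \<in> carrier G" "i \<in> I" "j \<in> J" for g i j
  proof -
    have "g \<star> i \<in> I" "conjugate G i (g \<star> j) \<in> J"
      using that assms carr
      by (auto simp: mult_lie_ideal_star normal_conjugate_closed mult_lie_ideal_normal)
    then show ?thesis
      using that carr by (auto simp: star_mult_right set_mult_def)
  qed
  then show ?thesis
    using assms normal_subgroup_set_mult_closed
    by (auto simp: mult_lie_ideal_def set_mult_def)
qed

lemma mem_star_subgroup: "\<lbrakk>a \<in> A; b \<in> B\<rbrakk> \<Longrightarrow> a \<star> b \<in> star_subgroup G A B"
  unfolding star_subgroup_def by (rule generate.incl) blast

lemma star_subgroup_subset: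
  assumes "subgroup N G" and "\<And>a b. \<lbrakk>a \<in> A; b \<in> B\<rbrakk> \<Longrightarrow> a \<star> b \<in> N"
  shows "star_subgroup G A B \<subseteq> N"
  unfolding star_subgroup_def using assms by (intro generate_subgroup_incl) auto

lemma star_subgroup_mono:
  assumes "A \<subseteq> A'" and "B \<subseteq> B'"
  shows "star_subgroup G A B \<subseteq> star_subgroup G A' B'"
  unfolding star_subgroup_def using assms by (intro mono_generate) blast

lemma star_subgroup_normal:
  assumes "A \<lhd> G" and "B \<lhd> G"
  shows "star_subgroup G A B \<lhd> G"
proof -
  have sub: "a \<in> carrier G" "b \<in> carrier G" if "a \<in> A" "b \<in> B" for a b
    using that assms by (auto intro: normal_mem_carrier)
  show ?thesis
    unfolding star_subgroup_def
  proof (rule normal_generate_conjugate)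
    show "{a \<star> b | a b. a \<in> A \<and> b \<in> B} \<subseteq> carrier G"
      using sub closed by blast
    fix x s assume x: "x \<in> carrier G" and "s \<in> {a \<star> b | a b. a \<in> A \<and> b \<in> B}"
    then obtain a b where s: "s = a \<star> b" and ab: "a \<in> A" "b \<in> B" by blast
    have "conjugate G x a \<in> A" "conjugate G x b \<in> B"
      using x ab assms by (simp_all add: normal_conjugate_closed)
    then show "conjugate G x s \<in> {a \<star> b | a b. a \<in> A \<and> b \<in> B}"
      using s star_conjugate[OF sub[OF ab] x] by blast
  qed
qed

lemma star_subgroup_le_ideal:
  assumes "mult_lie_ideal I G"
  shows "star_subgroup G (carrier G) I \<subseteq> I"
  using assms by (intro star_subgroup_subset) (auto simp: mult_lie_ideal_star mult_lie_ideal_subgroup)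

lemma star_subgroup_ideal:
  assumes "mult_lie_ideal I G"
  shows "mult_lie_ideal (star_subgroup G (carrier G) I) G"
  using assms star_subgroup_normal[OF normal_self] star_subgroup_le_ideal[OF assms]
  by (auto simp: mult_lie_ideal_def intro: mem_star_subgroup)

text \<open>
The map \<^term>\<open>\<lambda>c. g \<star> c\<close> is a crossed homomorphism, its failure to be multiplicative being a
conjugation. Normality of \<^term>\<open>N\<close> absorbs the conjugation, so statements about
\<^term>\<open>g \<star> c\<close> need only be checked when \<^term>\<open>c\<close> runs over generators.
\<close>
lemma star_preimage_subgroup:
  assumes N: "N \<lhd> G" and g: "g \<in> carrier G"
  shows "subgroup {c \<in> carrier G. g \<star> c \<in> N} G"
proof (rule subgroupI)
  have sub: "subgroup N G" using N by (rule normal_imp_subgroup)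
  then have "\<one> \<in> {c \<in> carrier G. g \<star> c \<in> N}"
    using g by (simp add: star_one_right subgroup.one_closed)
  then show "{c \<in> carrier G. g \<star> c \<in> N} \<noteq> {}" by blast
  fix a assume "a \<in> {c \<in> carrier G. g \<star> c \<in> N}"
  then have a: "a \<in> carrier G" "g \<star> a \<in> N" by auto
  have "(g \<star> a) \<otimes> conjugate G a (g \<star> inv a) = \<one>"
    using star_mult_right[of g a "inv a"] a g by (simp add: star_one_right)
  then have "conjugate G a (g \<star> inv a) = inv (g \<star> a)"
    using a g by (metis closed(1,2) inv_closed inv_equality inv_inv)
  then have "g \<star> inv a = conjugate G (inv a) (inv (g \<star> a))"
    using a g conjugate_cancel[of a "g \<star> inv a"] by (simp add: closed)
  then show "inv a \<in> {c \<in> carrier G. g \<star> c \<in> N}"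
    using a sub N by (simp add: normal_conjugate_closed subgroup.m_inv_closed)
  fix b assume "b \<in> {c \<in> carrier G. g \<star> c \<in> N}"
  with a show "a \<otimes> b \<in> {c \<in> carrier G. g \<star> c \<in> N}"
    using g N sub by (simp add: star_mult_right subgroup.m_closed normal_conjugate_closed)
qed auto

text \<open>
On a generator, \<^term>\<open>g \<star> commutator G a b\<close> equals \<^term>\<open>commutator G g (a \<star> b)\<close>; this is how every
star product with an element of a commutator subgroup is controlled below.
\<close>
lemma star_commutator_subgroup_closed:
  assumes N: "N \<lhd> G" and g: "g \<in> carrier G" and "A \<subseteq> carrier G" "B \<subseteq> carrier G"
    and gen: "\<And>a b. \<lbrakk>a \<in> A; b \<in> B\<rbrakk> \<Longrightarrow> commutator G g (a \<star> b) \<in> N"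
    and c: "c \<in> commutator_subgroup G A B"
  shows "g \<star> c \<in> N"
proof -
  have "commutator_subgroup G A B \<subseteq> {c \<in> carrier G. g \<star> c \<in> N}"
    using assms
    by (intro commutator_subgroup_subset star_preimage_subgroup)
       (auto simp: star_commutator closed subset_iff)
  then show ?thesis using c by blast
qed

text \<open>
Commutators with the ideal absorb the star: for \<^term>\<open>b \<in> I\<close> the inner factor of
\<^term>\<open>commutator G g (a \<star> b)\<close> lies in \<^term>\<open>I\<close> again.
\<close>
lemma commutator_subgroup_ideal:
  assumes I: "mult_lie_ideal I G"
  shows "mult_lie_ideal (commutator_subgroup G (carrier G) I) G"
proof -
  have N: "commutator_subgroup G (carrier G) I \<lhd> G"
    using I by (intro commutator_subgroup_normal normal_self mult_lie_ideal_normal)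
  have sub: "I \<subseteq> carrier G"
    using I by (simp add: mult_lie_ideal_subgroup subgroup.subset)
  have "g \<star> c \<in> commutator_subgroup G (carrier G) I"
    if "g \<in> carrier G" "c \<in> commutator_subgroup G (carrier G) I" for g c
    using N that(1) order.refl sub _ that(2)
  proof (rule star_commutator_subgroup_closed)
    fix a b assume "a \<in> carrier G" "b \<in> I"
    then show "commutator G g (a \<star> b) \<in> commutator_subgroup G (carrier G) I"
      using that(1) I by (intro mem_commutator_subgroup mult_lie_ideal_star)
  qed
  with N show ?thesis by (simp add: mult_lie_ideal_def)
qed

text \<open>
The terms of the Lie derived series are ideals only of their predecessors. This lemma cuts down
a normal subgroup of the whole group to an ideal of a subalgebra.
\<close>
lemma subalgebra_inter_ideal:
  assumes "subgroup H G" and "N \<lhd> G"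
    and "\<And>x y. \<lbrakk>x \<in> H; y \<in> H\<rbrakk> \<Longrightarrow> x \<star> y \<in> H"
    and "\<And>x y. \<lbrakk>x \<in> H; y \<in> N\<rbrakk> \<Longrightarrow> x \<star> y \<in> N"
  shows "mult_lie_ideal (N \<inter> H) (G\<lparr>carrier := H\<rparr>)"
  using assms normal_Int_subgroup[OF assms(1,2)] by (auto simp: mult_lie_ideal_def)

end

section \<open>Multiplicative Lie algebras on groups of class two\<close>

locale class_2_mult_lie_algebra = mult_lie_algebra +
  assumes class_2: "nilpotent_class_2 G"
begin

text \<open>
This is the derived subgroup, written so that the facts about commutator subgroups apply to it.
\<close>
abbreviation K where "K \<equiv> commutator_subgroup G (carrier G) (carrier G)"

lemma K_central: "\<lbrakk>c \<in> K; g \<in> carrier G\<rbrakk> \<Longrightarrow> c \<otimes> g = g \<otimes> c"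
proof -
  have "{commutator G a b | a b. a \<in> carrier G \<and> b \<in> carrier G} = derived_set G (carrier G)"
    by (auto simp: commutator_def)
  then have "K = derived G (carrier G)"
    by (simp add: commutator_subgroup_def derived_def)
  then show "\<lbrakk>c \<in> K; g \<in> carrier G\<rbrakk> \<Longrightarrow> c \<otimes> g = g \<otimes> c"
    using class_2 by (auto simp: nilpotent_class_2_def group_center_def)
qed

lemma K_ideal: "mult_lie_ideal K G"
  by (rule commutator_subgroup_ideal[OF carrier_ideal])

lemma K_carrier: "c \<in> K \<Longrightarrow> c \<in> carrier G"
  by (rule normal_mem_carrier[OF mult_lie_ideal_normal[OF K_ideal]])

text \<open>
On generators the value is \<^term>\<open>commutator G c (a \<star> b)\<close>, which is trivial because
\<^term>\<open>c\<close> is central.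
\<close>
lemma K_star_K:
  assumes c: "c \<in> K" and d: "d \<in> K"
  shows "c \<star> d = \<one>"
proof -
  have "c \<star> d \<in> {\<one>}"
    using one_is_normal K_carrier[OF c] order.refl order.refl _ d
  proof (rule star_commutator_subgroup_closed)
    fix a b assume ab: "a \<in> carrier G" "b \<in> carrier G"
    then show "commutator G c (a \<star> b) \<in> {\<one>}"
      using K_central[OF c, of "a \<star> b"] K_carrier[OF c] by (simp add: commutator_eq_one closed)
  qed
  then show ?thesis by simp
qed

lemma commutator_central_right:
  assumes "g \<in> carrier G" "s \<in> carrier G" "c \<in> K"
  shows "commutator G g (s \<otimes> c) = commutator G g s"
proof -
  have c: "c \<in> carrier G" using assms(3) by (rule K_carrier)
  have "commutator G g (s \<otimes> c) = g \<otimes> s \<otimes> (c \<otimes> inv g) \<otimes> (inv c \<otimes> inv s)"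
    using assms(1,2) c by (simp add: commutator_def m_assoc inv_mult_group)
  also have "\<dots> = g \<otimes> s \<otimes> (inv g \<otimes> c) \<otimes> (inv c \<otimes> inv s)"
    using assms K_central[of c "inv g"] by simp
  also have "\<dots> = commutator G g s"
    using assms(1,2) c by (simp add: commutator_def m_assoc inv_mult_cancel)
  finally show ?thesis .
qed

section \<open>Lie nilpotency\<close>

text \<open>
Write \<^term>\<open>h = s \<otimes> c\<close>. The group commutator \<^term>\<open>commutator G g h\<close> only sees \<^term>\<open>s\<close>, as
\<^term>\<open>c\<close> is central. The star product \<^term>\<open>g \<star> h\<close> contributes \<^term>\<open>g \<star> s\<close> and a conjugate of
\<^term>\<open>g \<star> c\<close>. The latter is a product of commutators of \<^term>\<open>g\<close> with elements of
\<^term>\<open>star_subgroup G (carrier G) A\<close>, hence with elements of \<^term>\<open>B\<close>: the star inside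
\<^term>\<open>g \<star> c\<close> is shifted into the second argument of the commutator.
\<close>
lemma lie_commutator_step:
  assumes A: "mult_lie_ideal A G" and B: "mult_lie_ideal B G"
    and AB: "star_subgroup G (carrier G) A \<subseteq> B"
    and g: "g \<in> carrier G" and h: "h \<in> B <#> commutator_subgroup G (carrier G) A"
  shows "lie_commutator G g h
    \<in> star_subgroup G (carrier G) B <#> commutator_subgroup G (carrier G) B"
    (is "_ \<in> ?J")
proof -
  let ?S = "star_subgroup G (carrier G) B" and ?C = "commutator_subgroup G (carrier G) B"
  have A_carr: "A \<subseteq> carrier G" and B_carr: "B \<subseteq> carrier G"
    using A B by (simp_all add: mult_lie_ideal_subgroup subgroup.subset)
  obtain s c where h_eq: "h = s \<otimes> c" and s: "s \<in> B"
    and c: "c \<in> commutator_subgroup G (carrier G) A"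
    using h by (auto simp: set_mult_def)
  have cK: "c \<in> K" using c A_carr commutator_subgroup_mono by blast
  note carr = g subsetD[OF B_carr s] K_carrier[OF cK]
  have S: "mult_lie_ideal ?S G" and C: "mult_lie_ideal ?C G"
    using B by (simp_all add: star_subgroup_ideal commutator_subgroup_ideal)
  have J: "subgroup ?J G"
    using S C by (intro mult_lie_ideal_subgroup set_mult_ideal)
  have gc: "g \<star> c \<in> ?C"
    using mult_lie_ideal_normal[OF C] g order.refl A_carr _ c
  proof (rule star_commutator_subgroup_closed)
    fix a b assume "a \<in> carrier G" "b \<in> A"
    then show "commutator G g (a \<star> b) \<in> ?C"
      using g AB mem_star_subgroup by (intro mem_commutator_subgroup) blast+
  qed
  have "g \<star> h \<in> ?J"
  proof -
    have "g \<star> s \<in> ?S" using g s by (rule mem_star_subgroup)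
    moreover have "conjugate G s (g \<star> c) \<in> ?C"
      using gc C carr by (simp add: normal_conjugate_closed mult_lie_ideal_normal)
    ultimately show ?thesis
      using carr by (auto simp: h_eq star_mult_right set_mult_def)
  qed
  moreover have "commutator G g h \<in> ?J"
  proof -
    have "\<one> \<in> ?S" using S by (simp add: mult_lie_ideal_subgroup subgroup.one_closed)
    moreover have "commutator G g h \<in> ?C"
      using g s carr cK by (simp add: h_eq commutator_central_right mem_commutator_subgroup)
    ultimately have "\<one> \<otimes> commutator G g h \<in> ?J" by (auto simp: set_mult_def)
    moreover have "commutator G g h \<in> carrier G" using carr by (simp add: h_eq closed)
    ultimately show ?thesis by simp
  qed
  ultimately show ?thesis
    using J by (simp add: lie_commutator_def subgroup.m_closed subgroup.m_inv_closed)
qed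

lemma star_lower_series_ideal: "mult_lie_ideal (star_lower_series G n) G"
proof (induction n)
  case 0
  show ?case by (simp add: carrier_ideal)
next
  case (Suc n)
  then show ?case by (cases n) (simp_all add: carrier_ideal star_subgroup_ideal)
qed

lemma star_lower_series_step:
  "star_subgroup G (carrier G) (star_lower_series G n) \<subseteq> star_lower_series G (Suc n)"
  using star_subgroup_le_ideal[OF carrier_ideal] by (cases n) simp_all

text \<open>
The second factor trails one step behind the first: it is generated by commutators with
the previous term of the star series. At index 0 both terms of the star series are the whole
group, so that the bound is trivial there.
\<close>
lemma lie_lower_series_subset:
  "lie_lower_series G n \<subseteq> star_lower_series G (Suc n)
     <#> commutator_subgroup G (carrier G) (star_lower_series G n)"
proof (induction n)
  case 0
  have "x \<in> carrier G <#> K" if "x \<in> carrier G" for x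
  proof -
    have "\<one> \<in> K" using K_ideal by (simp add: mult_lie_ideal_subgroup subgroup.one_closed)
    then have "x \<otimes> \<one> \<in> carrier G <#> K" using that unfolding set_mult_def by blast
    then show ?thesis using that by simp
  qed
  then show ?case by auto
next
  case (Suc n)
  let ?B = "star_lower_series G (Suc n)"
  let ?J = "star_lower_series G (Suc (Suc n)) <#> commutator_subgroup G (carrier G) ?B"
  have "mult_lie_ideal ?J G"
    by (intro set_mult_ideal commutator_subgroup_ideal star_lower_series_ideal)
  moreover have "lie_commutator G g h \<in> ?J"
    if "g \<in> carrier G" "h \<in> lie_lower_series G n" for g h
    using lie_commutator_step[OF star_lower_series_ideal star_lower_series_ideal
        star_lower_series_step that(1)] Suc that(2) by auto
  ultimately show ?case
    by (simp only: lie_lower_series.simps) (intro ideal_generated_minimal, auto)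
qed

theorem nilpotent_imp_lie_nilpotent:
  assumes "nilpotent_mult_lie G"
  shows "lie_nilpotent G"
proof -
  obtain n where n: "star_lower_series G n = {\<one>}" and "n \<ge> 1"
    using assms by (auto simp: nilpotent_mult_lie_def)
  then have "star_lower_series G (Suc n) = star_subgroup G (carrier G) {\<one>}"
    by (cases n) simp_all
  then have "star_lower_series G (Suc n) \<subseteq> {\<one>}"
    using star_subgroup_le_ideal[OF trivial_ideal] by simp
  moreover have "commutator_subgroup G (carrier G) {\<one>} \<subseteq> {\<one>}"
    by (intro commutator_subgroup_subset triv_subgroup) (auto simp: commutator_eq_one)
  ultimately have "star_lower_series G (Suc n)
      <#> commutator_subgroup G (carrier G) (star_lower_series G n) \<subseteq> {\<one>} <#> {\<one>}"
    unfolding n by (rule mono_set_mult)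
  with lie_lower_series_subset[of n] have "lie_lower_series G n \<subseteq> {\<one>} <#> {\<one>}"
    by (rule subset_trans)
  then have "lie_lower_series G n \<subseteq> {\<one>}"
    by (auto simp: set_mult_def)
  moreover have "\<one> \<in> lie_lower_series G n"
    by (cases n) (simp_all add: one_in_ideal_generated)
  ultimately show ?thesis
    unfolding lie_nilpotent_def by blast
qed

section \<open>Lie solvability\<close>

text \<open>
Since \<^term>\<open>K\<close> is a central ideal, factors from \<^term>\<open>K\<close> change a star product only by a
factor from \<^term>\<open>K\<close>.
\<close>
lemma star_mult_K:
  assumes s: "s \<in> carrier G" and t: "t \<in> carrier G" and c: "c \<in> K" and d: "d \<in> K"
  shows "\<exists>e\<in>K. (s \<otimes> c) \<star> (t \<otimes> d) = (s \<star> t) \<otimes> e"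
proof
  let ?w = "t \<otimes> d"
  let ?e = "conjugate G t (s \<star> d)" and ?f = "conjugate G s (c \<star> ?w)"
  have w: "?w \<in> carrier G" using t d K_carrier by simp
  have sub: "subgroup K G" using K_ideal by (rule mult_lie_ideal_subgroup)
  have e: "?e \<in> K"
    using K_ideal s t d by (simp add: normal_conjugate_closed mult_lie_ideal_normal mult_lie_ideal_star)
  have "inv (?w \<star> c) \<in> K"
    using K_ideal c w sub by (simp add: mult_lie_ideal_star subgroup.m_inv_closed)
  then have "c \<star> ?w \<in> K"
    using c w by (simp add: inv_star K_carrier)
  then have f: "?f \<in> K"
    using K_ideal s by (simp add: normal_conjugate_closed mult_lie_ideal_normal)
  show "?e \<otimes> ?f \<in> K" using sub e f by (rule subgroup.m_closed)
  have "(s \<otimes> c) \<star> ?w = ?f \<otimes> (s \<star> ?w)"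
    using s w c by (simp add: star_mult_left K_carrier)
  also have "\<dots> = (s \<star> ?w) \<otimes> ?f"
    using K_central[OF f] s w by (simp add: closed)
  also have "s \<star> ?w = (s \<star> t) \<otimes> ?e"
    using s t d by (simp add: star_mult_right K_carrier)
  finally show "(s \<otimes> c) \<star> ?w = (s \<star> t) \<otimes> (?e \<otimes> ?f)"
    using s t K_carrier[OF e] K_carrier[OF f] by (simp add: m_assoc closed)
qed

lemma star_set_mult_K:
  assumes "A \<subseteq> carrier G" "B \<subseteq> carrier G" and "x \<in> A <#> K" "y \<in> B <#> K"
  shows "x \<star> y \<in> star_subgroup G A B <#> K"
proof -
  obtain s c t d where "s \<in> A" "c \<in> K" "x = s \<otimes> c" "t \<in> B" "d \<in> K" "y = t \<otimes> d"
    using assms(3,4) by (auto simp: set_mult_def)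
  moreover from this obtain e where "e \<in> K" "x \<star> y = (s \<star> t) \<otimes> e"
    using star_mult_K assms(1,2) by blast
  ultimately show ?thesis
    using mem_star_subgroup unfolding set_mult_def by blast
qed

lemma star_derived_series_normal: "star_derived_series G n \<lhd> G"
  by (induction n) (simp_all add: normal_self star_subgroup_normal)

lemma star_derived_series_carrier: "star_derived_series G n \<subseteq> carrier G"
  using star_derived_series_normal by (auto intro: normal_mem_carrier)

lemma star_derived_series_Suc_subset: "star_derived_series G (Suc n) \<subseteq> star_derived_series G n"
proof (induction n)
  case 0
  show ?case using star_subgroup_le_ideal[OF carrier_ideal] by simp
next
  case (Suc n)
  then show ?case
    using star_subgroup_mono by (simp only: star_derived_series.simps)
qed

text \<open>
The inclusion is the point: modulo \<^term>\<open>K\<close> the Lie bracket is an inverse star product, so the Lie derived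
series is bounded by the star derived series. Being a subalgebra has to be carried along, since
the next term is an ideal generated inside the present one, and the bound for it is the
ideal \<^term>\<open>(star_derived_series G (Suc n) <#> K) \<inter> lie_derived_series G n\<close> of that subalgebra.
\<close>
lemma lie_derived_series_invariant:
  "subgroup (lie_derived_series G n) G \<and>
   (\<forall>x\<in>lie_derived_series G n. \<forall>y\<in>lie_derived_series G n. x \<star> y \<in> lie_derived_series G n) \<and>
   lie_derived_series G n \<subseteq> star_derived_series G n <#> K"
proof (induction n)
  case 0
  show ?case
    using lie_lower_series_subset[of 0] subgroup_self by (simp add: closed)
next
  case (Suc n)
  let ?H = "lie_derived_series G n" and ?D = "star_derived_series G"
  let ?N = "?D (Suc n) <#> K" and ?GH = "G\<lparr>carrier := lie_derived_series G n\<rparr>"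
  let ?S = "{lie_commutator G g h | g h. g \<in> ?H \<and> h \<in> ?H}"
  have H: "subgroup ?H G" and H_star: "\<And>x y. \<lbrakk>x \<in> ?H; y \<in> ?H\<rbrakk> \<Longrightarrow> x \<star> y \<in> ?H"
    and HD: "?H \<subseteq> ?D n <#> K"
    using Suc by auto
  have H_carr: "\<And>x. x \<in> ?H \<Longrightarrow> x \<in> carrier G"
    using H by (rule subgroup.mem_carrier)
  have N: "?N \<lhd> G"
    by (rule normal_subgroup_set_mult_closed[OF star_derived_series_normal
          mult_lie_ideal_normal[OF K_ideal]])
  have N_star: "x \<star> y \<in> ?N" if "x \<in> ?H" "y \<in> ?D n <#> K" for x y
    using star_set_mult_K[OF star_derived_series_carrier star_derived_series_carrier] that HD
    by auto
  have N_sub: "?N \<subseteq> ?D n <#> K"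
    using star_derived_series_Suc_subset by (intro mono_set_mult) auto
  have I: "mult_lie_ideal (?N \<inter> ?H) ?GH"
    using N_star N_sub by (intro subalgebra_inter_ideal H N H_star) blast+
  have "lie_commutator G g h \<in> ?N \<inter> ?H" if "g \<in> ?H" "h \<in> ?H" for g h
  proof
    have carr: "g \<in> carrier G" "h \<in> carrier G" using that H_carr by auto
    have "\<one> \<in> ?D (Suc n)"
      by (rule subgroup.one_closed[OF normal_imp_subgroup[OF star_derived_series_normal]])
    moreover have "commutator G g h \<in> K" using carr by (rule mem_commutator_subgroup)
    ultimately have "\<one> \<otimes> commutator G g h \<in> ?N" unfolding set_mult_def by blast
    then have "commutator G g h \<in> ?N" using carr by (simp add: closed)
    moreover have "g \<star> h \<in> ?N" using N_star that HD by blast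
    ultimately show "lie_commutator G g h \<in> ?N"
      unfolding lie_commutator_def using normal_imp_subgroup[OF N]
      by (meson subgroup.m_closed subgroup.m_inv_closed)
    show "lie_commutator G g h \<in> ?H"
      unfolding lie_commutator_def commutator_def
      using that H H_star by (simp add: subgroup.m_closed subgroup.m_inv_closed)
  qed
  then have S: "?S \<subseteq> ?N \<inter> ?H" by blast
  have L: "mult_lie_ideal (lie_derived_series G (Suc n)) ?GH"
    using ideal_generated_ideal[OF subgroup_imp_group[OF H] I S] by simp
  have sub: "lie_derived_series G (Suc n) \<subseteq> ?N \<inter> ?H"
    using ideal_generated_minimal[OF I S] by simp
  have "x \<star> y \<in> lie_derived_series G (Suc n)"
    if "x \<in> lie_derived_series G (Suc n)" "y \<in> lie_derived_series G (Suc n)" for x y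
    using mult_lie_ideal_star[OF L, of x y] that sub by auto
  then show ?case
    using incl_subgroup[OF H mult_lie_ideal_subgroup[OF L]] sub by blast
qed

text \<open>
When the star derived series vanishes, the Lie derived series has only been pushed into
\<^term>\<open>K\<close>. On \<^term>\<open>K\<close>, however, both the star and the commutator are trivial, so one more
step ends the series.
\<close>
theorem solvable_imp_lie_solvable:
  assumes "solvable_mult_lie G"
  shows "lie_solvable G"
proof -
  obtain n where n: "star_derived_series G n = {\<one>}"
    using assms by (auto simp: solvable_mult_lie_def)
  let ?H = "lie_derived_series G n"
  have "?H \<subseteq> {\<one>} <#> K"
    using lie_derived_series_invariant[of n] by (simp add: n)
  then have HK: "?H \<subseteq> K"
    using K_carrier by (fastforce simp: set_mult_def)
  have H: "subgroup ?H G"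
    using lie_derived_series_invariant[of n] by simp
  have "lie_commutator G g h = \<one>" if "g \<in> ?H" "h \<in> ?H" for g h
    using that HK K_star_K[of g h] K_central[of g h] K_carrier
    by (auto simp: lie_commutator_def commutator_eq_one subset_iff)
  then have "{lie_commutator G g h | g h. g \<in> ?H \<and> h \<in> ?H} \<subseteq> {\<one>} \<inter> ?H"
    using subgroup.one_closed[OF H] by auto
  moreover have "mult_lie_ideal ({\<one>} \<inter> ?H) (G\<lparr>carrier := ?H\<rparr>)"
    using lie_derived_series_invariant[of n]
    by (intro subalgebra_inter_ideal H one_is_normal)
       (auto simp: star_one_right subgroup.mem_carrier)
  ultimately have "lie_derived_series G (Suc n) \<subseteq> {\<one>}"
    unfolding lie_derived_series.simps by (meson ideal_generated_minimal inf.boundedE)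
  moreover have "\<one> \<in> lie_derived_series G (Suc n)"
    using one_in_ideal_generated[of "G\<lparr>carrier := ?H\<rparr>"] by simp
  ultimately show ?thesis
    unfolding lie_solvable_def by blast
qed

end

theorem theorem3p4:
  fixes G :: "('a, 'b) mult_lie_scheme"
  assumes "mult_lie_algebra G"
    and "nilpotent_class_2 G"
  shows "(nilpotent_mult_lie G \<longrightarrow> lie_nilpotent G) \<and>
         (solvable_mult_lie G \<longrightarrow> lie_solvable G)"
proof -
  interpret class_2_mult_lie_algebra G
    using assms by (simp add: class_2_mult_lie_algebra_def class_2_mult_lie_algebra_axioms_def)
  show ?thesis
    using nilpotent_imp_lie_nilpotent solvable_imp_lie_solvable by blast
qed

end
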